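(* Let $\alpha>1$, for every $d\in\mathbb{N}$ let $I_d=\{1,\ldots,\#I_d\}\subseteq\{1,\ldots,d\}$ be given (possibly empty), and let $N^*(d,I_d):=(\#I_d+1)\cdot2^{d-\#I_d}$. Then $$\nu_{d,N}\le e\big(N,d;\mathrm{Int}_d,\mathfrak{S}_{I_d}(E_{d,\alpha}^{\,\mu})\big)\le1$$ for all $d\in\mathbb{N}$ and every integer $N$ with $0\le N<N^*(d,I_d)$.
   Context: Notation: $\mathbb{N}=\{1,2,\ldots\}$, $\mathbb{N}_0=\{0\}\cup\mathbb{N}$, $\#I$ is the cardinality of $I$. For $f\in L_1([0,1]^d)$ (complex-valued) and $\boldsymbol{k}\in\mathbb{Z}^d$ let $\widehat f(\boldsymbol{k})=\int_{[0,1]^d}f(\boldsymbol{x})e^{-2\pi\mathrm{i}\,\boldsymbol{k}\boldsymbol{x}}\,\mathrm{d}\boldsymbol{x}$, where $\boldsymbol{k}\boldsymbol{x}=\sum_{m=1}^dk_mx_m$. For $k\in\mathbb{Z}$ put $\overline{k}:=\max\{1,|k|\}$. For $\boldsymbol{k}\in\mathbb{Z}^d$ let $\mathfrak{u}(\boldsymbol{k}):=\{m\in\{1,\ldots,d\}:k_m\ne0\}$. Product weights: for every $d\in\mathbb{N}$ real numbers $1\ge\gamma_{d,1}\ge\ldots\ge\gamma_{d,d}\ge0$ are given, and $\gamma_{d,\mathfrak{u}}:=\prod_{m\in\mathfrak{u}}\gamma_{d,m}$ for $\mathfrak{u}\subseteq\{1,\ldots,d\}$, with $\gamma_{d,\emptyset}=1$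 (empty products equal $1$). Permutations: $\mathcal{S}_{I_d}$ is the set of all bijections $\sigma$ of $\{1,\ldots,d\}$ that fix every element of $\{1,\ldots,d\}\setminus I_d$, acting on vectors by $\sigma(\boldsymbol{x})=(x_{\sigma(1)},\ldots,x_{\sigma(d)})$. Weights $\mu$: for $\boldsymbol{k}\in\mathbb{Z}^d$, $$\mu_{d,\mathfrak{u}(\boldsymbol{k})}:=\min_{\sigma\in\mathcal{S}_{I_d}}\gamma_{d,\mathfrak{u}(\sigma(\boldsymbol{k}))}=\prod_{i=1}^{\#(\mathfrak{u}(\boldsymbol{k})\cap I_d)}\gamma_{d,\#I_d-i+1}\cdot\prod_{m\in\mathfrak{u}(\boldsymbol{k})\setminus I_d}\gamma_{d,m}.$$ Weighted Korobov space: $$E_{d,\alpha}^{\,\mu}:=\Big\{f\in L_1([0,1]^d):\|f\|_\mu:=\sup_{\boldsymbol{k}\in\mathbb{Z}^d}|\widehat f(\boldsymbol{k})|\frac{(\overline{k_1}\cdots\overline{k_d})^\alpha}{\sqrt{\mu_{d,\mathfrak{u}(\boldsymbol{k})}}}<\infty\Big\}.$$ If $\mu_{d,\mathfrak{u}(\boldsymbol{k})}=0$, the corresponding term is read as $0$ if $\widehat f(\boldsymbol{k})=0$ and as $\infty$ otherwise; thus $\|f\|_\mu\le1$ iff $|\widehat f(\boldsymbol{k})|\le\sqrt{\mu_{d,\mathfrak{u}(\boldsymbol{k})}}\,(\overline{k_1}\cdots\overline{k_d})^{-\alpha}$ for all $\boldsymbol{k}$. Every $f\in E_{d,\alpha}^{\,\mu}$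 has an absolutely convergent Fourier series and is identified with the ($1$-periodic, continuous) function given by it. $\mathfrak{S}_{I_d}(E_{d,\alpha}^{\,\mu})$ is the subspace of all $f\in E_{d,\alpha}^{\,\mu}$ with $f(\boldsymbol{x})=f(\sigma(\boldsymbol{x}))$ for all $\boldsymbol{x}\in[0,1]^d$, $\sigma\in\mathcal{S}_{I_d}$, with the same norm. Ordered weights: let $$\nabla_d:=\{\boldsymbol{k}=(\boldsymbol{m},\boldsymbol{l})\in\{0,1\}^{\#I_d}\times\{0,1\}^{d-\#I_d}: m_1\le\ldots\le m_{\#I_d}\},$$ which has $N^*(d,I_d)$ elements. Let $\psi:\{0,1,\ldots,\#\nabla_d-1\}\to\nabla_d$ be a bijection such that $\nu_{d,n}:=\mu_{d,\mathfrak{u}(\psi(n))}$ satisfies $\nu_{d,n}\ge\nu_{d,n+1}$ for $n=0,1,\ldots,\#\nabla_d-2$. Thus $\nu_{d,N}$ is the $(N+1)$st largest of the weights $\mu_{d,\mathfrak{u}(\boldsymbol{k})}$, $\boldsymbol{k}\in\nabla_d$ (counted with multiplicity). Integration: $\mathrm{Int}_d(f)=\int_{[0,1]^d}f(\boldsymbol{x})\,\mathrm{d}\boldsymbol{x}$. A linear cubature rule using at most $N\in\mathbb{N}_0$ function values is $\mathcal{A}_{N,d}(f)=\sum_{n=1}^Nw_nf(\boldsymbol{t}^{(n)})$ with arbitrary $w_n\in\mathbb{C}$ and $\boldsymbol{t}^{(n)}\in[0,1]^d$ (for $N=0$ it is the zero functional). For a normed space $F$ of such functions, $$e(N,d;\mathrm{Int}_d,F):=\inf_{\mathcal{A}_{N,d}}\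 \sup_{f\in F,\ \|f\|_F\le1}|\mathrm{Int}_d(f)-\mathcal{A}_{N,d}(f)|,$$ the infimum being over all such rules. *)

theory Defs
  imports "HOL-Analysis.Analysis" "HOL-Combinatorics.Permutations"
begin

text \<open>
  Vectors of length \<open>d\<close> are functions on \<open>nat\<close> that are extensional on \<open>{1..d}\<close>, so that
  \<open>d\<close> can be an ordinary variable.
\<close>

definition cube :: "nat \<Rightarrow> (nat \<Rightarrow> real) set" where
  "cube d = {1..d} \<rightarrow>\<^sub>E {0..1}"

definition freqs :: "nat \<Rightarrow> (nat \<Rightarrow> int) set" where
  "freqs d = {1..d} \<rightarrow>\<^sub>E UNIV"

text \<open>Lebesgue measure on \<open>[0,1]\<^sup>d\<close>; the underlying space is \<open>cube d\<close>.\<close>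

definition cube_measure :: "nat \<Rightarrow> (nat \<Rightarrow> real) measure" where
  "cube_measure d = Pi\<^sub>M {1..d} (\<lambda>_. restrict_space lborel {0..1})"

definition dotp :: "nat \<Rightarrow> (nat \<Rightarrow> int) \<Rightarrow> (nat \<Rightarrow> real) \<Rightarrow> real" where
  "dotp d k x = (\<Sum>m\<in>{1..d}. real_of_int (k m) * x m)"

definition fourier_coeff :: "nat \<Rightarrow> ((nat \<Rightarrow> real) \<Rightarrow> complex) \<Rightarrow> (nat \<Rightarrow> int) \<Rightarrow> complex" where
  "fourier_coeff d f k =
     (LINT x|cube_measure d. f x * exp (- (2 * complex_of_real pi * \<i> * complex_of_real (dotp d k x))))"

definition freq_support :: "nat \<Rightarrow> (nat \<Rightarrow> int) \<Rightarrow> nat set" where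
  "freq_support d k = {m \<in> {1..d}. k m \<noteq> 0}"

definition product_weights :: "(nat \<Rightarrow> nat \<Rightarrow> real) \<Rightarrow> bool" where
  "product_weights \<gamma> \<longleftrightarrow>
     (\<forall>d\<ge>1. \<gamma> d 1 \<le> 1 \<and> (\<forall>m. 1 \<le> m \<and> m < d \<longrightarrow> \<gamma> d (m + 1) \<le> \<gamma> d m) \<and> 0 \<le> \<gamma> d d)"

definition gamma_weight :: "(nat \<Rightarrow> nat \<Rightarrow> real) \<Rightarrow> nat \<Rightarrow> nat set \<Rightarrow> real" where
  "gamma_weight \<gamma> d u = (\<Prod>m\<in>u. \<gamma> d m)"

text \<open>
  A bijection of \<open>{1..d}\<close> is represented by its extension by the identity; it acts on a
  vector \<open>x\<close> by \<open>x \<circ> \<sigma>\<close>, which is again extensional on \<open>{1..d}\<close>.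
\<close>

definition coord_perms :: "nat \<Rightarrow> nat set \<Rightarrow> (nat \<Rightarrow> nat) set" where
  "coord_perms d I = {\<sigma>. \<sigma> permutes {1..d} \<and> (\<forall>m\<in>{1..d} - I. \<sigma> m = m)}"

definition mu_weight :: "(nat \<Rightarrow> nat \<Rightarrow> real) \<Rightarrow> nat \<Rightarrow> nat set \<Rightarrow> (nat \<Rightarrow> int) \<Rightarrow> real" where
  "mu_weight \<gamma> d I k =
     Min ((\<lambda>\<sigma>. gamma_weight \<gamma> d (freq_support d (k \<circ> \<sigma>))) ` coord_perms d I)"

text \<open>
  Division in \<open>ereal\<close> satisfies \<open>0 / 0 = 0\<close> and \<open>c / 0 = \<infinity>\<close> for \<open>c > 0\<close>, which is the
  convention wanted for frequencies of weight zero.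
\<close>

definition korobov_norm ::
  "real \<Rightarrow> (nat \<Rightarrow> nat \<Rightarrow> real) \<Rightarrow> nat \<Rightarrow> nat set \<Rightarrow> ((nat \<Rightarrow> real) \<Rightarrow> complex) \<Rightarrow> ereal" where
  "korobov_norm \<alpha> \<gamma> d I f =
     (SUP k\<in>freqs d.
        ereal (cmod (fourier_coeff d f k) * (\<Prod>m\<in>{1..d}. max 1 \<bar>real_of_int (k m)\<bar>) powr \<alpha>)
        / ereal (sqrt (mu_weight \<gamma> d I k)))"

text \<open>
  The last condition selects, in each class of \<open>L\<^sub>1\<close>-functions, the representative given on
  \<open>cube d\<close> by its (unconditionally convergent) Fourier series. Values outside \<open>cube d\<close> are
  irrelevant.
\<close>

definition korobov_space ::
  "real \<Rightarrow> (nat \<Rightarrow> nat \<Rightarrow> real) \<Rightarrow> nat \<Rightarrow> nat set \<Rightarrow> ((nat \<Rightarrow> real) \<Rightarrow> complex) set" where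
  "korobov_space \<alpha> \<gamma> d I =
     {f. integrable (cube_measure d) f \<and> korobov_norm \<alpha> \<gamma> d I f < \<infinity> \<and>
         (\<forall>x\<in>cube d.
            ((\<lambda>k. fourier_coeff d f k * exp (2 * complex_of_real pi * \<i> * complex_of_real (dotp d k x)))
               has_sum f x) (freqs d))}"

definition sym_korobov_space ::
  "real \<Rightarrow> (nat \<Rightarrow> nat \<Rightarrow> real) \<Rightarrow> nat \<Rightarrow> nat set \<Rightarrow> ((nat \<Rightarrow> real) \<Rightarrow> complex) set" where
  "sym_korobov_space \<alpha> \<gamma> d I =
     {f \<in> korobov_space \<alpha> \<gamma> d I. \<forall>x\<in>cube d. \<forall>\<sigma>\<in>coord_perms d I. f x = f (x \<circ> \<sigma>)}"

text \<open>For \<open>I = {1..card I}\<close>, these are the 0-1 vectors whose \<open>I\<close>-part is nondecreasing.\<close>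

definition nabla :: "nat \<Rightarrow> nat set \<Rightarrow> (nat \<Rightarrow> int) set" where
  "nabla d I = {k \<in> {1..d} \<rightarrow>\<^sub>E {0, 1}. \<forall>i\<in>I. \<forall>j\<in>I. i \<le> j \<longrightarrow> k i \<le> k j}"

definition Nstar :: "nat \<Rightarrow> nat set \<Rightarrow> nat" where
  "Nstar d I = (card I + 1) * 2 ^ (d - card I)"

definition integral_cube :: "nat \<Rightarrow> ((nat \<Rightarrow> real) \<Rightarrow> complex) \<Rightarrow> complex" where
  "integral_cube d f = (LINT x|cube_measure d. f x)"

definition cubature ::
  "nat \<Rightarrow> (nat \<Rightarrow> complex) \<Rightarrow> (nat \<Rightarrow> nat \<Rightarrow> real) \<Rightarrow> ((nat \<Rightarrow> real) \<Rightarrow> complex) \<Rightarrow> complex" where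
  "cubature N w t f = (\<Sum>n\<in>{1..N}. w n * f (t n))"

text \<open>The \<open>N\<close>-th minimal worst-case error of integration on the normed space \<open>(F, nrm)\<close>.\<close>

definition min_error ::
  "nat \<Rightarrow> nat \<Rightarrow> ((nat \<Rightarrow> real) \<Rightarrow> complex) set \<Rightarrow> (((nat \<Rightarrow> real) \<Rightarrow> complex) \<Rightarrow> ereal) \<Rightarrow> ereal" where
  "min_error N d F nrm =
     (INF (w, t)\<in>{(w, t). \<forall>n\<in>{1..N}. t n \<in> cube d}.
        SUP f\<in>{f \<in> F. nrm f \<le> 1}. ereal (cmod (integral_cube d f - cubature N w t f)))"

end

theory Submission
  imports Defs
begin

text \<open>
  The upper bound comes from the zero rule: the integral of \<open>f\<close> is its Fourier coefficient at
  frequency \<open>0\<close>, where the weight equals \<open>1\<close>, so it is at most \<open>1\<close> in modulus on the unit ball.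

  For the lower bound one constructs, for any \<open>N\<close> nodes, a function of the unit ball that vanishes
  at all nodes and has integral \<open>\<nu> = \<nu>\<^sub>d\<^sub>,\<^sub>N\<close> (\<open>fooling_function\<close>); every rule that uses these nodes
  errs on it by \<open>\<nu>\<close>. Let \<open>K\<close> consist of the \<open>N + 1\<close> frequencies of \<open>\<nabla>\<^sub>d\<close> of largest
  weight, let \<open>S\<^sub>k\<close> be the sum of the characters \<open>e\<^sub>l(x) = exp(2\<pi>i l\<cdot>x)\<close> over the orbit of \<open>k\<close> under
  the coordinate permutations, and choose coefficients \<open>a\<^sub>k\<close>, not all zero, such that
  \<open>\<Sum>\<^sub>k a\<^sub>k S\<^sub>k\<close> vanishes at the nodes (\<open>N\<close> equations in \<open>N + 1\<close> unknowns). With \<open>p\<close> such that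
  \<open>\<bar>a\<^sub>p\<bar>\<close> is maximal, the function is a multiple of
  \<open>f = (\<Sum>\<^sub>k a\<^sub>k S\<^sub>k) \<cdot> cnj S\<^sub>p = \<Sum> a\<^sub>k e\<^bsub>l - q\<^esub>\<close>, summed over \<open>k \<in> K\<close>,
  \<open>l\<close> in the orbit of \<open>k\<close> and \<open>q\<close> in the orbit of \<open>p\<close>.
  It is symmetric and still vanishes at the nodes; multiplying by \<open>cnj S\<^sub>p\<close> moves the
  largest coefficient to frequency \<open>0\<close>. As the orbits of distinct elements of \<open>\<nabla>\<^sub>d\<close> are
  disjoint (\<open>nabla_orbits_disjoint\<close>), a frequency \<open>h\<close> and a \<open>q\<close> determine \<open>l\<close> and \<open>k\<close> in
  \<open>h = l - q\<close>. So every Fourier coefficient is at most \<open>\<bar>a\<^sub>p\<bar>\<close> times the length of the orbit of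
  \<open>p\<close>, and the coefficient at \<open>0\<close> attains this bound. Normalize \<open>f\<close> so that the latter is \<open>\<nu>\<close>.

  It remains to see that the norm is at most \<open>1\<close>. All occurring frequencies \<open>h = l - q\<close> have
  entries in \<open>{-1, 0, 1}\<close>, so the smoothness factor is \<open>1\<close>, and one needs
  \<open>\<nu> \<le> sqrt (\<mu> h)\<close>. The support of \<open>l - q\<close> is covered by those of \<open>l\<close> and \<open>q\<close>, and the
  factors \<open>\<gamma>\<^sub>d\<^sub>,\<^sub>m\<close> lie in \<open>[0, 1]\<close>; hence \<open>\<mu> h \<ge> \<mu> l \<cdot> \<mu> q \<ge> \<nu>\<^sup>2\<close> (\<open>mu_weight_freq_diff\<close>).
\<close>

section \<open>Underdetermined linear systems\<close>

text \<open>
  Gaussian elimination, for index sets instead of matrices: a nonzero entry \<open>M n p\<close> of the new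
  equation is used to eliminate the unknown \<open>p\<close> from the others.
\<close>

lemma underdetermined_homogeneous_system:
  fixes M :: "'b \<Rightarrow> 'a \<Rightarrow> 'c::field"
  assumes "finite B" "finite A" "card B < card A"
  shows "\<exists>a. (\<exists>j\<in>A. a j \<noteq> 0) \<and> (\<forall>n\<in>B. (\<Sum>j\<in>A. a j * M n j) = 0)"
  using assms
proof (induction B arbitrary: A M rule: finite_induct)
  case empty
  then have "A \<noteq> {}" by auto
  then show ?case by (intro exI[of _ "\<lambda>_. 1"]) auto
next
  case (insert n B)
  show ?case
  proof (cases "\<forall>j\<in>A. M n j = 0")
    case True
    have "card B < card A" using insert by simp
    from insert.IH[OF insert.prems(1) this, of M] True show ?thesis by auto
  next
    case False
    then obtain p where p: "p \<in> A" "M n p \<noteq> 0" by auto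
    define M' where "M' = (\<lambda>m j. M m j - M m p * M n j / M n p)"
    have "card B < card (A - {p})" using insert p by simp
    from insert.IH[OF _ this, of M'] insert.prems obtain a where
      a: "\<exists>j\<in>A - {p}. a j \<noteq> 0" "\<forall>m\<in>B. (\<Sum>j\<in>A - {p}. a j * M' m j) = 0" by auto
    define s where "s = (\<Sum>j\<in>A - {p}. a j * M n j)"
    define b where "b = a(p := - s / M n p)"
    have split: "(\<Sum>j\<in>A. b j * M m j) = - s / M n p * M m p + (\<Sum>j\<in>A - {p}. a j * M m j)" for m
    proof -
      have "(\<Sum>j\<in>A - {p}. b j * M m j) = (\<Sum>j\<in>A - {p}. a j * M m j)"
        by (rule sum.cong) (auto simp: b_def)
      then show ?thesis using sum.remove[OF insert.prems(1) p(1), of "\<lambda>j. b j * M m j"]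
        by (simp add: b_def)
    qed
    have "(\<Sum>j\<in>A. b j * M m j) = 0" if "m \<in> insert n B" for m
    proof (cases "m = n")
      case True
      then show ?thesis using split[of n] p by (simp add: s_def)
    next
      case False
      with that a(2) have "0 = (\<Sum>j\<in>A - {p}. a j * M' m j)" by auto
      also have "\<dots> = (\<Sum>j\<in>A - {p}. a j * M m j - M m p / M n p * (a j * M n j))"
        by (rule sum.cong) (auto simp: M'_def field_simps)
      also have "\<dots> = (\<Sum>j\<in>A - {p}. a j * M m j) - M m p / M n p * s"
        by (simp add: sum_subtractf sum_distrib_left s_def)
      finally show ?thesis using split[of m] by (simp add: field_simps)
    qed
    moreover have "\<exists>j\<in>A. b j \<noteq> 0" using a(1) by (auto simp: b_def)
    ultimately show ?thesis by blast
  qed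
qed

section \<open>Fourier coefficients of trigonometric polynomials\<close>

lemma interval_character_integral:
  fixes k :: int
  defines "e \<equiv> (\<lambda>x::real. exp (2 * complex_of_real pi * \<i> * complex_of_real (of_int k * x)))"
  shows "integrable (restrict_space lborel {0..1}) e"
    and "(LINT x|restrict_space lborel {0..1}. e x) = (if k = 0 then 1 else 0)"
proof -
  have cont: "continuous_on {0..1} e"
    unfolding e_def by (intro continuous_intros)
  then have int: "set_integrable lborel {0..1} e"
    by (rule borel_integrable_atLeastAtMost')
  then show "integrable (restrict_space lborel {0..1}) e"
    by (subst integrable_restrict_space) (auto simp: set_integrable_def)
  have "(LINT x|restrict_space lborel {0..1}. e x) = (LINT x|lborel. indicator {0..1} x *\<^sub>R e x)"
    by (subst integral_restrict_space) auto
  also have "\<dots> = (if k = 0 then 1 else 0)"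
  proof (cases "k = 0")
    case True
    then show ?thesis by (simp add: e_def)
  next
    case False
    define c where "c = 2 * complex_of_real pi * \<i> * of_int k"
    have c0: "c \<noteq> 0" using False by (simp add: c_def)
    have e: "e = (\<lambda>x. exp (c * of_real x))" by (auto simp: e_def c_def mult_ac)
    have "((\<lambda>x. exp (c * of_real x) / c) has_vector_derivative e x) (at x within {0..1})" for x
    proof -
      have "((\<lambda>z. exp (c * z) / c) has_field_derivative exp (c * of_real x)) (at (of_real x))"
        using c0 by (auto intro!: derivative_eq_intros)
      from has_vector_derivative_real_field[OF this] show ?thesis by (simp add: e)
    qed
    from integral_FTC_atLeastAtMost[OF _ this cont]
    have "(LINT x|lborel. indicator {0..1} x *\<^sub>R e x) = exp c / c - 1 / c"
      by simp
    moreover have "exp c = 1"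
      using exp_integer_2pi[of "of_int k"] by (simp add: c_def mult_ac)
    ultimately show ?thesis using False by simp
  qed
  finally show "(LINT x|restrict_space lborel {0..1}. e x) = (if k = 0 then 1 else 0)" .
qed

definition wave :: "nat \<Rightarrow> (nat \<Rightarrow> int) \<Rightarrow> (nat \<Rightarrow> real) \<Rightarrow> complex" where
  "wave d k x = exp (2 * complex_of_real pi * \<i> * complex_of_real (dotp d k x))"

text \<open>The difference is restricted to \<open>{1..d}\<close> because elements of \<open>freqs d\<close> are undefined elsewhere.\<close>

definition freq_diff :: "nat \<Rightarrow> (nat \<Rightarrow> int) \<Rightarrow> (nat \<Rightarrow> int) \<Rightarrow> nat \<Rightarrow> int" where
  "freq_diff d k l = (\<lambda>m\<in>{1..d}. k m - l m)"

lemma freq_diff_in_freqs: "freq_diff d k l \<in> freqs d"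
  by (auto simp: freq_diff_def freqs_def)

lemma cnj_wave: "cnj (wave d k x) = exp (- (2 * complex_of_real pi * \<i> * complex_of_real (dotp d k x)))"
  by (simp add: wave_def exp_cnj)

lemma wave_mult_cnj: "wave d k x * cnj (wave d l x) = wave d (freq_diff d k l) x"
proof -
  have "dotp d (freq_diff d k l) x = dotp d k x - dotp d l x"
    by (simp add: dotp_def freq_diff_def sum_subtractf algebra_simps)
  then show ?thesis
    unfolding cnj_wave by (simp add: wave_def exp_add[symmetric] right_diff_distrib del: exp_diff)
qed

lemma wave_cube_integral:
  shows "integrable (cube_measure d) (wave d k)"
    and "(LINT x|cube_measure d. wave d k x) = (if \<forall>m\<in>{1..d}. k m = 0 then 1 else 0)"
proof -
  interpret product_sigma_finite "\<lambda>_::nat. restrict_space lborel {0..1::real}"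
    unfolding product_sigma_finite_def
    by (intro allI sigma_finite_measure_restrict_space lborel.sigma_finite_measure_axioms) simp
  have w: "wave d k = (\<lambda>x. \<Prod>m\<in>{1..d}. exp (2 * complex_of_real pi * \<i> * complex_of_real (of_int (k m) * x m)))"
    by (simp add: wave_def dotp_def exp_sum[symmetric] sum_distrib_left fun_eq_iff)
  show "integrable (cube_measure d) (wave d k)"
    unfolding w cube_measure_def
    by (intro product_integrable_prod interval_character_integral) auto
  have "(LINT x|cube_measure d. wave d k x) = (\<Prod>m\<in>{1..d}. if k m = 0 then 1 else (0::complex))"
    unfolding w cube_measure_def
    by (subst product_integral_prod) (auto intro: interval_character_integral simp: interval_character_integral(2) simp del: of_real_mult)
  also have "\<dots> = (if \<forall>m\<in>{1..d}. k m = 0 then 1 else 0)"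
    by (auto intro: prod.neutral simp del: prod.delta)
  finally show "(LINT x|cube_measure d. wave d k x) = (if \<forall>m\<in>{1..d}. k m = 0 then 1 else 0)" .
qed

text \<open>
  The frequencies \<open>\<phi> i\<close> may repeat: expanding a product of two exponential sums
  produces each frequency several times.
\<close>

lemma trig_poly_fourier_coeff:
  assumes "finite A" "\<And>i. i \<in> A \<Longrightarrow> \<phi> i \<in> freqs d" "h \<in> freqs d"
  shows "fourier_coeff d (\<lambda>x. \<Sum>i\<in>A. c i * wave d (\<phi> i) x) h = (\<Sum>i\<in>{i\<in>A. \<phi> i = h}. c i)"
proof -
  have iff: "(\<forall>m\<in>{1..d}. freq_diff d (\<phi> i) h m = 0) \<longleftrightarrow> \<phi> i = h" if "i \<in> A" for i
    using assms(2)[OF that] assms(3)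
    by (auto simp: freq_diff_def freqs_def simp del: One_nat_def intro: PiE_ext)
  have "fourier_coeff d (\<lambda>x. \<Sum>i\<in>A. c i * wave d (\<phi> i) x) h
      = (LINT x|cube_measure d. (\<Sum>i\<in>A. c i * wave d (freq_diff d (\<phi> i) h) x))"
    unfolding fourier_coeff_def cnj_wave[symmetric] wave_mult_cnj[symmetric]
    by (simp add: sum_distrib_right mult.assoc)
  also have "\<dots> = (\<Sum>i\<in>A. c i * (if \<forall>m\<in>{1..d}. freq_diff d (\<phi> i) h m = 0 then 1 else 0))"
    by (subst Bochner_Integration.integral_sum) (auto intro: wave_cube_integral simp: wave_cube_integral(2))
  also have "\<dots> = (\<Sum>i\<in>A. if \<phi> i = h then c i else 0)"
    by (rule sum.cong[OF refl]) (simp only: iff mult_1_right mult_zero_right if_distrib[of "(*) _"])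
  also have "\<dots> = (\<Sum>i\<in>{i\<in>A. \<phi> i = h}. c i)"
    using assms(1) by (simp add: sum.inter_filter)
  finally show ?thesis .
qed

lemma trig_poly_fourier_series:
  fixes c :: "'i \<Rightarrow> complex"
  assumes "finite A" "\<And>i. i \<in> A \<Longrightarrow> \<phi> i \<in> freqs d"
  defines "f \<equiv> (\<lambda>x. \<Sum>i\<in>A. c i * wave d (\<phi> i) x)"
  shows "((\<lambda>k. fourier_coeff d f k * wave d k x) has_sum f x) (freqs d)"
proof -
  have co: "fourier_coeff d f h = (\<Sum>i\<in>{i\<in>A. \<phi> i = h}. c i)" if "h \<in> freqs d" for h
    unfolding f_def by (rule trig_poly_fourier_coeff) (use assms that in auto)
  have "f x = (\<Sum>h\<in>\<phi> ` A. \<Sum>i\<in>{i\<in>A. \<phi> i = h}. c i * wave d (\<phi> i) x)"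
    unfolding f_def by (rule sum.image_gen) fact
  also have "\<dots> = (\<Sum>h\<in>\<phi> ` A. fourier_coeff d f h * wave d h x)"
    using assms(2) by (intro sum.cong) (auto simp: co sum_distrib_right)
  finally have eq: "(\<Sum>h\<in>\<phi> ` A. fourier_coeff d f h * wave d h x) = f x" ..
  show ?thesis
  proof (rule has_sum_finite_neutralI[where B = "\<phi> ` A"])
    fix h assume "h \<in> freqs d - \<phi> ` A"
    then have *: "{i \<in> A. \<phi> i = h} = {}" and h: "h \<in> freqs d" by auto
    show "fourier_coeff d f h * wave d h x = 0" unfolding co[OF h] * by simp
  qed (use assms eq in auto)
qed

section \<open>Weights\<close>

lemma product_weights_unit:
  assumes "product_weights \<gamma>" "m \<in> {1..d}"
  shows "0 \<le> \<gamma> d m" "\<gamma> d m \<le> 1"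
proof -
  have d: "d \<ge> 1" using assms by auto
  have anti: "\<gamma> d j \<le> \<gamma> d i" if "1 \<le> i" "i \<le> j" "j \<le> d" for i j
    using that(2,3)
  proof (induction j rule: dec_induct)
    case (step n)
    then show ?case using step(3) \<open>1 \<le> i\<close> assms(1) d
      by (smt (verit, best) Suc_eq_plus1 Suc_le_lessD le_trans less_imp_le_nat product_weights_def)
  qed auto
  have "\<gamma> d 1 \<le> 1" "0 \<le> \<gamma> d d" using assms(1) d by (auto simp: product_weights_def)
  with anti[of 1 m] anti[of m d] assms(2) show "0 \<le> \<gamma> d m" "\<gamma> d m \<le> 1" by auto
qed

lemma gamma_weight_unit:
  assumes "product_weights \<gamma>" "u \<subseteq> {1..d}"
  shows "0 \<le> gamma_weight \<gamma> d u" "gamma_weight \<gamma> d u \<le> 1"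
  unfolding gamma_weight_def
  using product_weights_unit[OF assms(1)] assms(2)
  by (auto intro!: prod_nonneg prod_le_1 simp: subset_eq)

lemma gamma_weight_antimono:
  assumes "product_weights \<gamma>" "v \<subseteq> {1..d}" "u \<subseteq> v"
  shows "gamma_weight \<gamma> d v \<le> gamma_weight \<gamma> d u"
proof -
  have fin: "finite v" using finite_subset[OF assms(2)] by simp
  have "gamma_weight \<gamma> d v = gamma_weight \<gamma> d (v - u) * gamma_weight \<gamma> d u"
    unfolding gamma_weight_def using prod.subset_diff[OF assms(3) fin] by simp
  also have "\<dots> \<le> gamma_weight \<gamma> d u"
    using gamma_weight_unit[OF assms(1), of u d] gamma_weight_unit[OF assms(1), of "v - u" d] assms
    by (intro mult_left_le_one_le) auto
  finally show ?thesis .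
qed

text \<open>
  The product on the left counts the factors on \<open>v \<inter> w\<close> twice and has factors outside \<open>u\<close>;
  as all factors lie in \<open>[0, 1]\<close>, both can only make it smaller.
\<close>

lemma gamma_weight_cover:
  assumes "product_weights \<gamma>" "v \<subseteq> {1..d}" "w \<subseteq> {1..d}" "u \<subseteq> v \<union> w"
  shows "gamma_weight \<gamma> d v * gamma_weight \<gamma> d w \<le> gamma_weight \<gamma> d u"
proof -
  have fin: "finite v" "finite w" using finite_subset[OF assms(2)] finite_subset[OF assms(3)] by simp_all
  have "gamma_weight \<gamma> d v * gamma_weight \<gamma> d w
      = gamma_weight \<gamma> d (v \<inter> w) * gamma_weight \<gamma> d (v \<union> w)"
    unfolding gamma_weight_def using prod.union_inter[OF fin, of "\<gamma> d"] by (simp add: mult.commute)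
  also have "\<dots> \<le> gamma_weight \<gamma> d (v \<union> w)"
    using gamma_weight_unit[OF assms(1), of "v \<union> w" d] gamma_weight_unit[OF assms(1), of "v \<inter> w" d] assms
    by (intro mult_left_le_one_le) auto
  also have "\<dots> \<le> gamma_weight \<gamma> d u"
    using assms by (intro gamma_weight_antimono) auto
  finally show ?thesis .
qed

lemma finite_coord_perms: "finite (coord_perms d I)"
  by (rule finite_subset[OF _ finite_permutations[of "{1..d}"]]) (auto simp: coord_perms_def)

lemma id_coord_perm: "id \<in> coord_perms d I"
  by (simp add: coord_perms_def permutes_id)

lemma coord_perms_comp:
  assumes "\<sigma> \<in> coord_perms d I" "\<tau> \<in> coord_perms d I"
  shows "\<sigma> \<circ> \<tau> \<in> coord_perms d I"
  using assms by (auto simp: coord_perms_def intro: permutes_compose)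

lemma coord_perms_inv:
  assumes "\<sigma> \<in> coord_perms d I"
  shows "inv \<sigma> \<in> coord_perms d I"
  using assms by (auto simp: coord_perms_def permutes_inv permutes_inv_eq)

lemma freq_support_subset: "freq_support d k \<subseteq> {1..d}"
  by (auto simp: freq_support_def)

lemma mu_weight_le:
  assumes "\<sigma> \<in> coord_perms d I"
  shows "mu_weight \<gamma> d I k \<le> gamma_weight \<gamma> d (freq_support d (k \<circ> \<sigma>))"
  unfolding mu_weight_def using assms finite_coord_perms by (intro Min_le) auto

lemma mu_weight_greatest:
  assumes "\<And>\<sigma>. \<sigma> \<in> coord_perms d I \<Longrightarrow> c \<le> gamma_weight \<gamma> d (freq_support d (k \<circ> \<sigma>))"
  shows "c \<le> mu_weight \<gamma> d I k"
  unfolding mu_weight_def using assms finite_coord_perms id_coord_perm[of d I]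
  by (subst Min_ge_iff) auto

lemma mu_weight_unit:
  assumes "product_weights \<gamma>"
  shows "0 \<le> mu_weight \<gamma> d I k" "mu_weight \<gamma> d I k \<le> 1"
proof -
  show "0 \<le> mu_weight \<gamma> d I k"
    by (intro mu_weight_greatest gamma_weight_unit assms freq_support_subset)
  show "mu_weight \<gamma> d I k \<le> 1"
    using mu_weight_le[OF id_coord_perm] gamma_weight_unit(2)[OF assms freq_support_subset]
    by (rule order_trans)
qed

lemma mu_weight_zero:
  assumes "\<And>m. m \<in> {1..d} \<Longrightarrow> k m = 0"
  shows "mu_weight \<gamma> d I k = 1"
proof -
  have "freq_support d (k \<circ> \<sigma>) = {}" if "\<sigma> \<in> coord_perms d I" for \<sigma>
    using that assms permutes_in_image[of \<sigma> "{1..d}"]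
    by (auto simp: freq_support_def coord_perms_def)
  then have "(\<lambda>\<sigma>. gamma_weight \<gamma> d (freq_support d (k \<circ> \<sigma>))) ` coord_perms d I = {1}"
    using id_coord_perm[of d I] by (auto simp: gamma_weight_def image_iff)
  then show ?thesis by (simp add: mu_weight_def)
qed

text \<open>
  The minimum defining the weight of \<open>k \<circ> \<tau>\<close> runs over terms that also occur for \<open>k\<close>.
\<close>

lemma mu_weight_permuted:
  assumes "\<tau> \<in> coord_perms d I"
  shows "mu_weight \<gamma> d I k \<le> mu_weight \<gamma> d I (k \<circ> \<tau>)"
  using mu_weight_le[OF coord_perms_comp[OF assms]]
  by (intro mu_weight_greatest) (simp add: comp_assoc)

text \<open>
  This holds before taking minima: for every permutation \<open>\<sigma>\<close> the support of
  \<open>(k - l) \<circ> \<sigma>\<close> is covered by the supports of \<open>k \<circ> \<sigma>\<close> and \<open>l \<circ> \<sigma>\<close>.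
\<close>

lemma mu_weight_freq_diff:
  assumes "product_weights \<gamma>"
  shows "mu_weight \<gamma> d I k * mu_weight \<gamma> d I l \<le> mu_weight \<gamma> d I (freq_diff d k l)"
proof (rule mu_weight_greatest)
  fix \<sigma> assume \<sigma>: "\<sigma> \<in> coord_perms d I"
  have "mu_weight \<gamma> d I k * mu_weight \<gamma> d I l
      \<le> gamma_weight \<gamma> d (freq_support d (k \<circ> \<sigma>)) * gamma_weight \<gamma> d (freq_support d (l \<circ> \<sigma>))"
    using \<sigma> assms by (intro mult_mono mu_weight_le mu_weight_unit gamma_weight_unit freq_support_subset)
  also have "\<dots> \<le> gamma_weight \<gamma> d (freq_support d (freq_diff d k l \<circ> \<sigma>))"
    using \<sigma> permutes_in_image[of \<sigma> "{1..d}"]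
    by (intro gamma_weight_cover assms freq_support_subset)
       (auto simp: freq_support_def freq_diff_def coord_perms_def)
  finally show "mu_weight \<gamma> d I k * mu_weight \<gamma> d I l
      \<le> gamma_weight \<gamma> d (freq_support d (freq_diff d k l \<circ> \<sigma>))" .
qed

section \<open>Orbits and symmetrized characters\<close>

definition orbit :: "nat \<Rightarrow> nat set \<Rightarrow> (nat \<Rightarrow> int) \<Rightarrow> (nat \<Rightarrow> int) set" where
  "orbit d I k = (\<lambda>\<sigma>. k \<circ> \<sigma>) ` coord_perms d I"

definition sym_wave :: "nat \<Rightarrow> nat set \<Rightarrow> (nat \<Rightarrow> int) \<Rightarrow> (nat \<Rightarrow> real) \<Rightarrow> complex" where
  "sym_wave d I k x = (\<Sum>l\<in>orbit d I k. wave d l x)"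

lemma finite_orbit: "finite (orbit d I k)"
  by (simp add: orbit_def finite_coord_perms)

lemma self_in_orbit: "k \<in> orbit d I k"
  unfolding orbit_def by (rule image_eqI[OF _ id_coord_perm]) simp

lemma wave_permuted:
  assumes "\<sigma> \<in> coord_perms d I"
  shows "wave d k (x \<circ> \<sigma>) = wave d (k \<circ> inv \<sigma>) x"
proof -
  have p: "\<sigma> permutes {1..d}" using assms by (simp add: coord_perms_def)
  have "(\<Sum>m\<in>{1..d}. real_of_int (k m) * x (\<sigma> m)) = (\<Sum>m\<in>{1..d}. real_of_int (k (inv \<sigma> m)) * x m)"
    by (rule sum.reindex_bij_witness[of _ "inv \<sigma>" \<sigma>])
       (use p permutes_inverses[OF p] permutes_in_image[OF p] permutes_in_image[OF permutes_inv[OF p]] in auto)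
  then show ?thesis by (simp add: wave_def dotp_def)
qed

lemma sym_wave_permuted:
  assumes \<sigma>: "\<sigma> \<in> coord_perms d I"
  shows "sym_wave d I k (x \<circ> \<sigma>) = sym_wave d I k x"
proof -
  have p: "\<sigma> permutes {1..d}" using assms by (simp add: coord_perms_def)
  have closed: "l \<circ> \<tau> \<in> orbit d I k" if "l \<in> orbit d I k" "\<tau> \<in> coord_perms d I" for l \<tau>
    using that coord_perms_comp by (auto simp: orbit_def comp_assoc)
  show ?thesis unfolding sym_wave_def wave_permuted[OF \<sigma>]
    by (rule sum.reindex_bij_witness[of _ "\<lambda>l. l \<circ> \<sigma>" "\<lambda>l. l \<circ> inv \<sigma>"])
       (auto intro: closed \<sigma> coord_perms_inv simp: comp_assoc permutes_inv_o[OF p])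
qed

lemma orbit_binary:
  assumes "k \<in> nabla d I" "l \<in> orbit d I k" "m \<in> {1..d}"
  shows "l m \<in> {0, 1}"
proof -
  obtain \<sigma> where s: "\<sigma> permutes {1..d}" "l = k \<circ> \<sigma>"
    using assms(2) by (auto simp: orbit_def coord_perms_def)
  have "\<sigma> m \<in> {1..d}" using permutes_in_image[OF s(1)] assms(3) by blast
  then show ?thesis using assms(1) s(2) by (auto simp: nabla_def PiE_iff)
qed

lemma nabla_orbit_in_freqs:
  assumes "k \<in> nabla d I" "l \<in> orbit d I k"
  shows "l \<in> freqs d"
proof -
  obtain \<sigma> where s: "\<sigma> permutes {1..d}" "l = k \<circ> \<sigma>"
    using assms(2) by (auto simp: orbit_def coord_perms_def)
  have "k m = undefined" if "m \<notin> {1..d}" for m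
    using assms(1) that by (auto simp: nabla_def PiE_iff extensional_def)
  then show ?thesis using s permutes_not_in[OF s(1)] by (auto simp: freqs_def PiE_iff extensional_def)
qed

text \<open>
  A monotone 0-1 vector is determined by its number of ones, which a permutation preserves. For
  one inequality: if \<open>(k \<circ> \<sigma>) i = 1\<close> and \<open>k i = 0\<close>, then by monotonicity all ones of \<open>k\<close> lie to
  the right of \<open>i\<close>, where \<open>k \<circ> \<sigma>\<close> has only ones; so \<open>k \<circ> \<sigma>\<close> has more ones than \<open>k\<close>.
\<close>

lemma nabla_le_permuted:
  assumes k: "k \<in> nabla d I" and l: "k \<circ> \<sigma> \<in> nabla d I"
    and \<sigma>: "\<sigma> \<in> coord_perms d I" and I: "I \<subseteq> {1..d}" and i: "i \<in> I"
  shows "(k \<circ> \<sigma>) i \<le> k i"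
proof (rule ccontr)
  assume neg: "\<not> ?thesis"
  have p: "\<sigma> permutes {1..d}" using \<sigma> by (simp add: coord_perms_def)
  have fixed: "\<sigma> m = m" if "m \<notin> I" for m
    using \<sigma> that permutes_not_in[OF p] unfolding coord_perms_def by blast
  have inI: "\<sigma> m \<in> I \<longleftrightarrow> m \<in> I" for m
    using fixed permutes_inj[OF p] by (metis injD)
  have bin: "k m \<in> {0,1}" "(k \<circ> \<sigma>) m \<in> {0,1}" if "m \<in> I" for m
    using k l that I by (auto simp: nabla_def PiE_iff)
  have i01: "k i = 0" "(k \<circ> \<sigma>) i = 1" using neg bin[OF i] by auto
  have "\<sigma> ` {m\<in>I. (k \<circ> \<sigma>) m = 1} = {m\<in>I. k m = 1}"
    using inI permutes_surj[OF p] by (auto simp: image_iff) (metis surjD inI)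
  then have card: "card {m\<in>I. (k \<circ> \<sigma>) m = 1} = card {m\<in>I. k m = 1}"
    using card_image[OF inj_on_subset[OF permutes_inj[OF p]]] by (metis subset_UNIV)
  have "{m\<in>I. k m = 1} \<subset> {m\<in>I. (k \<circ> \<sigma>) m = 1}"
  proof
    show "{m\<in>I. k m = 1} \<subseteq> {m\<in>I. (k \<circ> \<sigma>) m = 1}"
    proof safe
      fix m assume m: "m \<in> I" "k m = 1"
      have "\<not> m \<le> i" using k m i i01 by (force simp: nabla_def)
      then have "(k \<circ> \<sigma>) i \<le> (k \<circ> \<sigma>) m" using l m i by (auto simp: nabla_def)
      then show "(k \<circ> \<sigma>) m = 1" using i01 bin[OF m(1)] by auto
    qed
    have "i \<in> {m\<in>I. (k \<circ> \<sigma>) m = 1}" "i \<notin> {m\<in>I. k m = 1}" using i i01 by auto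
    then show "{m\<in>I. k m = 1} \<noteq> {m\<in>I. (k \<circ> \<sigma>) m = 1}" by blast
  qed
  moreover have "finite I" using finite_subset[OF I] by simp
  ultimately have "card {m\<in>I. k m = 1} < card {m\<in>I. (k \<circ> \<sigma>) m = 1}"
    by (intro psubset_card_mono) auto
  with card show False by simp
qed

text \<open>
  The elements of \<open>nabla d I\<close> are sorted representatives of the orbits of 0-1 vectors. If the orbits
  of two of them meet, then each is a permutation of the other, and on \<open>I\<close> they are equal by
  applying \<open>nabla_le_permuted\<close> in both directions.
\<close>

lemma nabla_orbits_disjoint:
  assumes k: "k \<in> nabla d I" and k': "k' \<in> nabla d I" and I: "I \<subseteq> {1..d}"
    and l: "l \<in> orbit d I k" "l \<in> orbit d I k'"
  shows "k = k'"
proof -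
  obtain \<sigma> \<tau> where s: "\<sigma> \<in> coord_perms d I" "l = k \<circ> \<sigma>" and t: "\<tau> \<in> coord_perms d I" "l = k' \<circ> \<tau>"
    using l by (auto simp: orbit_def)
  have ps: "\<sigma> permutes {1..d}" and pt: "\<tau> permutes {1..d}"
    using s t by (auto simp: coord_perms_def)
  define \<rho> where "\<rho> = \<sigma> \<circ> inv \<tau>"
  have r: "\<rho> \<in> coord_perms d I" "k' = k \<circ> \<rho>"
    unfolding \<rho>_def using s t coord_perms_comp coord_perms_inv permutes_inv_o[OF pt]
    by (auto simp: comp_assoc[symmetric]) (metis comp_assoc comp_id)
  define \<rho>' where "\<rho>' = \<tau> \<circ> inv \<sigma>"
  have r': "\<rho>' \<in> coord_perms d I" "k = k' \<circ> \<rho>'"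
    unfolding \<rho>'_def using s t coord_perms_comp coord_perms_inv permutes_inv_o[OF ps]
    by (auto simp: comp_assoc[symmetric]) (metis comp_assoc comp_id)
  show ?thesis
  proof
    fix m
    show "k m = k' m"
    proof (cases "m \<in> I")
      case True
      then show ?thesis using nabla_le_permuted[of k d I \<rho> m] nabla_le_permuted[of k' d I \<rho>' m]
        using k k' r r' I by force
    next
      case False
      then have "\<rho> m = m"
        using r(1) permutes_not_in[of \<rho> "{1..d}" m] unfolding coord_perms_def by blast
      then show ?thesis using r(2) by simp
    qed
  qed
qed

lemma finite_nabla: "finite (nabla d I)"
  by (rule finite_subset[OF _ finite_PiE[of "{1..d}" "\<lambda>_. {0,1::int}"]]) (auto simp: nabla_def)

text \<open>
  An element of \<open>nabla d I\<close> is given by the last position \<open>c \<in> {0..p}\<close> of a zero in \<open>I = {1..p}\<close>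
  (\<open>0\<close> if there is none) and by its arbitrary support \<open>S\<close> outside \<open>I\<close>. Injectivity of this
  parametrization gives the inequality.
\<close>

lemma Nstar_le_card_nabla:
  assumes "I \<subseteq> {1..d}" "I = {1..p}"
  shows "Nstar d I \<le> card (nabla d I)"
proof -
  define \<Phi> where "\<Phi> = (\<lambda>(c, S). \<lambda>i\<in>{1..d}. if i \<in> {c<..p} \<union> S then 1 else (0::int))"
  let ?D = "{0..p} \<times> Pow {p+1..d}"
  have pd: "p \<le> d" using assms by (cases p) auto
  have supp: "{i\<in>{1..d}. \<Phi> (c, S) i = 1} = {c<..p} \<union> S" if "(c, S) \<in> ?D" for c S
    using that pd by (auto simp: \<Phi>_def)
  have "inj_on \<Phi> ?D"
  proof (rule inj_onI, clarify)
    fix c S c' S' assume h: "c \<in> {0..p}" "S \<subseteq> {p+1..d}" "c' \<in> {0..p}" "S' \<subseteq> {p+1..d}" "\<Phi> (c, S) = \<Phi> (c', S')"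
    have eq: "{c<..p} \<union> S = {c'<..p} \<union> S'"
      using supp[of c S] supp[of c' S'] h by simp
    have "S = ({c<..p} \<union> S) \<inter> {p+1..d}" "S' = ({c'<..p} \<union> S') \<inter> {p+1..d}"
      using h by auto
    moreover have "{c<..p} = ({c<..p} \<union> S) \<inter> {..p}" "{c'<..p} = ({c'<..p} \<union> S') \<inter> {..p}"
      using h by auto
    ultimately have "S = S'" "{c<..p} = {c'<..p}" using eq by auto
    then have "card {c<..p} = card {c'<..p}" by simp
    with h \<open>S = S'\<close> show "c = c' \<and> S = S'" by auto
  qed
  moreover have "\<Phi> ` ?D \<subseteq> nabla d I"
    using pd unfolding assms(2) by (auto simp: nabla_def \<Phi>_def split: if_splits)
  ultimately have "card ?D \<le> card (nabla d I)"
    using card_inj_on_le finite_nabla by blast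
  then show ?thesis using assms(2) by (simp add: Nstar_def card_Pow card_cartesian_product)
qed


section \<open>The unit ball of the Korobov space\<close>

lemma integral_eq_fourier_coeff: "integral_cube d f = fourier_coeff d f (\<lambda>m\<in>{1..d}. 0)"
  by (simp add: integral_cube_def fourier_coeff_def dotp_def)

text \<open>
  For frequencies with entries in \<open>{-1, 0, 1}\<close> all smoothness factors equal \<open>1\<close>.
\<close>

lemma korobov_norm_le_1I:
  assumes "\<And>h. h \<in> freqs d \<Longrightarrow> fourier_coeff d f h \<noteq> 0 \<Longrightarrow>
      (\<forall>m\<in>{1..d}. \<bar>h m\<bar> \<le> 1) \<and> cmod (fourier_coeff d f h) \<le> sqrt (mu_weight \<gamma> d I h)"
  shows "korobov_norm \<alpha> \<gamma> d I f \<le> 1"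
  unfolding korobov_norm_def
proof (rule SUP_least)
  fix h assume h: "h \<in> freqs d"
  let ?c = "cmod (fourier_coeff d f h)" and ?s = "sqrt (mu_weight \<gamma> d I h)"
  show "ereal (?c * (\<Prod>m\<in>{1..d}. max 1 \<bar>real_of_int (h m)\<bar>) powr \<alpha>) / ereal ?s \<le> 1"
  proof (cases "fourier_coeff d f h = 0")
    case True
    then show ?thesis by simp
  next
    case False
    have "max 1 \<bar>real_of_int (h m)\<bar> = 1" if "m \<in> {1..d}" for m
    proof -
      have "\<bar>h m\<bar> \<le> 1" using assms[OF h False] that by blast
      then show ?thesis by linarith
    qed
    then have "(\<Prod>m\<in>{1..d}. max 1 \<bar>real_of_int (h m)\<bar>) = 1" by (intro prod.neutral) blast
    moreover have c: "0 < ?c" "?c \<le> ?s" using False assms[OF h False] by auto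
    then have "?s > 0" by linarith
    then have "?s \<noteq> 0" "?c / ?s \<le> 1" using c(2) by simp_all
    ultimately show ?thesis by simp
  qed
qed

lemma integral_le_korobov_norm:
  assumes "korobov_norm \<alpha> \<gamma> d I f \<le> 1"
  shows "cmod (integral_cube d f) \<le> 1"
proof -
  let ?z = "\<lambda>m\<in>{1..d}. 0 :: int"
  have "ereal (cmod (fourier_coeff d f ?z) * (\<Prod>m\<in>{1..d}. max 1 \<bar>real_of_int (?z m)\<bar>) powr \<alpha>)
      / ereal (sqrt (mu_weight \<gamma> d I ?z)) \<le> korobov_norm \<alpha> \<gamma> d I f"
    unfolding korobov_norm_def by (rule SUP_upper) (auto simp: freqs_def)
  with assms have "ereal (cmod (fourier_coeff d f ?z) * (\<Prod>m\<in>{1..d}. max 1 \<bar>real_of_int (?z m)\<bar>) powr \<alpha>)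
      / ereal (sqrt (mu_weight \<gamma> d I ?z)) \<le> 1" by (rule order_trans[rotated])
  then show ?thesis
    unfolding integral_eq_fourier_coeff using mu_weight_zero[of d ?z \<gamma> I] by simp
qed

section \<open>The fooling function\<close>

text \<open>
  The construction sketched at the beginning, for a set \<open>T\<close> of nodes with fewer elements
  than the set \<open>K\<close> of frequencies.
\<close>

lemma fooling_function:
  assumes w: "product_weights \<gamma>" and I: "I \<subseteq> {1..d}"
    and K: "K \<subseteq> nabla d I" and T: "finite T" "card T < card K"
    and \<nu>: "0 \<le> \<nu>" "\<And>k. k \<in> K \<Longrightarrow> \<nu> \<le> mu_weight \<gamma> d I k"
  shows "\<exists>f\<in>sym_korobov_space \<alpha> \<gamma> d I. korobov_norm \<alpha> \<gamma> d I f \<le> 1 \<and>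
           integral_cube d f = complex_of_real \<nu> \<and> (\<forall>x\<in>T. f x = 0)"
proof -
  have finK: "finite K" using K finite_nabla finite_subset by blast
  obtain a where a: "\<exists>k\<in>K. a k \<noteq> 0" "\<forall>x\<in>T. (\<Sum>k\<in>K. a k * sym_wave d I k x) = 0"
    using underdetermined_homogeneous_system[OF T(1) finK T(2), of "\<lambda>x k. sym_wave d I k x"] by blast
  have "Max ((\<lambda>k. cmod (a k)) ` K) \<in> (\<lambda>k. cmod (a k)) ` K"
    using finK a(1) by (intro Max_in) auto
  then obtain p where p: "p \<in> K" "cmod (a p) = Max ((\<lambda>k. cmod (a k)) ` K)" by auto
  have a_le: "cmod (a k) \<le> cmod (a p)" if "k \<in> K" for k
    using finK that by (simp add: p(2))
  have ap: "a p \<noteq> 0" using a(1) a_le by force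
  define M where "M = card (orbit d I p)"
  have M: "M > 0" unfolding M_def using finite_orbit self_in_orbit[of p d I] card_gt_0_iff by blast
  (* The normalization makes the M terms of f at frequency 0 sum up to \<nu>. *)
  define b where "b = (\<lambda>k. of_real \<nu> * a k / (a p * of_nat M))"
  define f where "f = (\<lambda>x. (\<Sum>k\<in>K. b k * sym_wave d I k x) * cnj (sym_wave d I p x))"
  have bp: "b p = of_real \<nu> / of_nat M" using ap by (simp add: b_def)
  have b_le: "cmod (b k) \<le> \<nu> / M" if "k \<in> K" for k
  proof -
    have "cmod (b k) = \<nu> / M * (cmod (a k) / cmod (a p))"
      using \<nu>(1) by (simp add: b_def norm_mult norm_divide)
    also have "\<dots> \<le> \<nu> / M * 1"
      using a_le[OF that] ap \<nu>(1) by (intro mult_left_mono) (auto simp: divide_simps)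
    finally show ?thesis by simp
  qed
  (* The expansion of f into characters is indexed by triples ((k, l), q) with l in the orbit of
     k and q in the orbit of p; the corresponding term is b k times the character of l - q. *)
  define A where "A = (SIGMA k:K. orbit d I k) \<times> orbit d I p"
  define \<phi> where "\<phi> = (\<lambda>((k::nat \<Rightarrow> int, l), q). freq_diff d l q)"
  define c where "c = (\<lambda>((k, l::nat \<Rightarrow> int), q::nat \<Rightarrow> int). b k)"
  have finA: "finite A" unfolding A_def using finK finite_orbit by auto
  have \<phi>_freqs: "\<phi> i \<in> freqs d" for i
    by (auto simp: \<phi>_def freq_diff_in_freqs split: prod.split)
  have orbit_freqs: "l \<in> freqs d" if "k \<in> K" "l \<in> orbit d I k" for k l
    using nabla_orbit_in_freqs that K by blast
  have f_poly: "f = (\<lambda>x. \<Sum>i\<in>A. c i * wave d (\<phi> i) x)"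
  proof
    fix x
    have "(\<Sum>k\<in>K. b k * sym_wave d I k x) = (\<Sum>(k, l)\<in>(SIGMA k:K. orbit d I k). b k * wave d l x)"
      unfolding sym_wave_def sum_distrib_left using finK finite_orbit by (subst sum.Sigma) auto
    then have "f x = (\<Sum>(k, l)\<in>(SIGMA k:K. orbit d I k). b k * wave d l x) * (\<Sum>q\<in>orbit d I p. cnj (wave d q x))"
      by (simp add: f_def sym_wave_def)
    also have "\<dots> = (\<Sum>i\<in>A. c i * wave d (\<phi> i) x)"
      unfolding sum_product sum.cartesian_product A_def
      by (rule sum.cong) (auto simp: c_def \<phi>_def wave_mult_cnj[symmetric])
    finally show "f x = (\<Sum>i\<in>A. c i * wave d (\<phi> i) x)" .
  qed
  have coeff: "fourier_coeff d f h = (\<Sum>i\<in>{i\<in>A. \<phi> i = h}. c i)" if "h \<in> freqs d" for h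
    unfolding f_poly using finA \<phi>_freqs that by (rule trig_poly_fourier_coeff)
  have diff_eq: "l = l'" if "freq_diff d l q = freq_diff d l' q" "l \<in> freqs d" "l' \<in> freqs d" for l l' q
  proof (rule PiE_ext)
    show "l \<in> {1..d} \<rightarrow>\<^sub>E UNIV" "l' \<in> {1..d} \<rightarrow>\<^sub>E UNIV" using that by (simp_all add: freqs_def)
    show "l m = l' m" if "m \<in> {1..d}" for m
      using fun_cong[OF \<open>freq_diff d l q = freq_diff d l' q\<close>, of m] that by (simp add: freq_diff_def)
  qed
  (* Given h, the component q determines the whole triple with l - q = h, so h collects at most M
     terms, each bounded by \<nu> / M. *)
  have coeff_le: "cmod (fourier_coeff d f h) \<le> \<nu>" if h: "h \<in> freqs d" for h
  proof -
    have inj: "inj_on snd {i\<in>A. \<phi> i = h}"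
    proof (rule inj_onI)
      fix i j assume i: "i \<in> {i\<in>A. \<phi> i = h}" and j: "j \<in> {i\<in>A. \<phi> i = h}" and e: "snd i = snd j"
      obtain k l q where i': "i = ((k, l), q)" by (metis surj_pair)
      obtain k' l' where j': "j = ((k', l'), q)" using e i' by (metis surj_pair snd_conv)
      have kl: "k \<in> K" "l \<in> orbit d I k" "k' \<in> K" "l' \<in> orbit d I k'"
        "freq_diff d l q = freq_diff d l' q"
        using i j by (auto simp: i' j' A_def \<phi>_def)
      then have "l = l'" using diff_eq orbit_freqs by blast
      moreover have "k = k'" using nabla_orbits_disjoint[OF _ _ I] kl K \<open>l = l'\<close> by blast
      ultimately show "i = j" by (simp add: i' j')
    qed
    have "snd ` {i\<in>A. \<phi> i = h} \<subseteq> orbit d I p" by (auto simp: A_def)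
    then have card: "card {i\<in>A. \<phi> i = h} \<le> M"
      unfolding M_def using card_inj_on_le[OF inj _ finite_orbit] by blast
    have "cmod (fourier_coeff d f h) \<le> (\<Sum>i\<in>{i\<in>A. \<phi> i = h}. cmod (c i))"
      unfolding coeff[OF h] by (rule norm_sum)
    also have "\<dots> \<le> of_nat (card {i\<in>A. \<phi> i = h}) * (\<nu> / M)"
      by (rule sum_bounded_above) (auto simp: A_def c_def intro: b_le)
    also have "\<dots> \<le> real M * (\<nu> / M)"
      using card \<nu>(1) by (intro mult_right_mono) auto
    finally show ?thesis using M by simp
  qed
  have norm: "korobov_norm \<alpha> \<gamma> d I f \<le> 1"
  proof (rule korobov_norm_le_1I)
    fix h assume h: "h \<in> freqs d" "fourier_coeff d f h \<noteq> 0"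
    then have "{i\<in>A. \<phi> i = h} \<noteq> {}" unfolding coeff[OF h(1)] by (metis sum.empty)
    then obtain k l q where i: "k \<in> K" "l \<in> orbit d I k" "q \<in> orbit d I p" "h = freq_diff d l q"
      by (auto simp: A_def \<phi>_def)
    have bin: "l m \<in> {0, 1}" "q m \<in> {0, 1}" if "m \<in> {1..d}" for m
      using orbit_binary[of _ d I] i p(1) K that by blast+
    have small: "\<bar>h m\<bar> \<le> 1" if "m \<in> {1..d}" for m
      using bin[OF that] that by (auto simp: i(4) freq_diff_def)
    have orb: "\<nu> \<le> mu_weight \<gamma> d I l'" if kl: "k' \<in> K" "l' \<in> orbit d I k'" for k' l'
    proof -
      obtain \<sigma> where "\<sigma> \<in> coord_perms d I" "l' = k' \<circ> \<sigma>"
        using kl(2) unfolding orbit_def by blast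
      then show ?thesis
        using \<nu>(2)[OF kl(1)] mu_weight_permuted[of \<sigma> d I \<gamma> k'] by simp
    qed
    have "\<nu>\<^sup>2 \<le> mu_weight \<gamma> d I l * mu_weight \<gamma> d I q"
      unfolding power2_eq_square using orb[OF i(1,2)] orb[OF p(1) i(3)] \<nu>(1)
      by (intro mult_mono) auto
    also have "\<dots> \<le> mu_weight \<gamma> d I h" unfolding i(4) by (rule mu_weight_freq_diff[OF w])
    finally have "\<nu> \<le> sqrt (mu_weight \<gamma> d I h)" by (rule real_le_rsqrt)
    then have "cmod (fourier_coeff d f h) \<le> sqrt (mu_weight \<gamma> d I h)"
      using coeff_le[OF h(1)] by simp
    with small show "(\<forall>m\<in>{1..d}. \<bar>h m\<bar> \<le> 1) \<and> cmod (fourier_coeff d f h) \<le> sqrt (mu_weight \<gamma> d I h)"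
      by simp
  qed
  have int: "integral_cube d f = of_real \<nu>"
  proof -
    let ?z = "\<lambda>m\<in>{1..d}. 0 :: int"
    have zz: "freq_diff d l l = ?z" for l by (simp add: freq_diff_def)
    (* l = q lies in the orbits of k and of p, which forces k = p. *)
    have "{i\<in>A. \<phi> i = ?z} = (\<lambda>q. ((p, q), q)) ` orbit d I p"
    proof (intro set_eqI iffI)
      fix i assume i: "i \<in> {i\<in>A. \<phi> i = ?z}"
      then obtain k l q where i': "i = ((k, l), q)" "k \<in> K" "l \<in> orbit d I k" "q \<in> orbit d I p"
        "freq_diff d l q = freq_diff d q q"
        unfolding zz by (auto simp: A_def \<phi>_def)
      have "l = q" using diff_eq[OF i'(5)] orbit_freqs i' p(1) by blast
      moreover have "k = p" using nabla_orbits_disjoint[OF _ _ I] i' p(1) K \<open>l = q\<close> by blast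
      ultimately show "i \<in> (\<lambda>q. ((p, q), q)) ` orbit d I p" using i' by auto
    next
      fix i assume "i \<in> (\<lambda>q. ((p, q), q)) ` orbit d I p"
      then show "i \<in> {i\<in>A. \<phi> i = ?z}" using p(1) zz by (auto simp: A_def \<phi>_def)
    qed
    moreover have "?z \<in> freqs d" by (simp add: freqs_def)
    ultimately have "fourier_coeff d f ?z = (\<Sum>i\<in>(\<lambda>q. ((p, q), q)) ` orbit d I p. c i)"
      using coeff by simp
    also have "\<dots> = (\<Sum>q\<in>orbit d I p. b p)"
      by (subst sum.reindex) (auto simp: inj_on_def c_def)
    also have "\<dots> = of_real \<nu>" using M by (simp add: bp M_def[symmetric])
    finally show ?thesis by (simp add: integral_eq_fourier_coeff)
  qed
  have zero: "f x = 0" if "x \<in> T" for x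
  proof -
    have "(\<Sum>k\<in>K. b k * sym_wave d I k x) = of_real \<nu> / (a p * of_nat M) * (\<Sum>k\<in>K. a k * sym_wave d I k x)"
      unfolding sum_distrib_left by (rule sum.cong) (auto simp: b_def)
    then show ?thesis using a(2) that by (simp add: f_def)
  qed
  have "integrable (cube_measure d) f"
    unfolding f_poly by (intro Bochner_Integration.integrable_sum integrable_mult_right wave_cube_integral)
  moreover have "((\<lambda>k. fourier_coeff d f k * exp (2 * complex_of_real pi * \<i> * complex_of_real (dotp d k x)))
               has_sum f x) (freqs d)" for x
  proof -
    have "((\<lambda>k. fourier_coeff d f k * wave d k x) has_sum (\<Sum>i\<in>A. c i * wave d (\<phi> i) x)) (freqs d)"
      using trig_poly_fourier_series[OF finA, of \<phi> d c x] \<phi>_freqs unfolding f_poly[symmetric] by blast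
    then show ?thesis unfolding fun_cong[OF f_poly, of x, symmetric] unfolding wave_def .
  qed
  moreover have "f x = f (x \<circ> \<sigma>)" if "\<sigma> \<in> coord_perms d I" for x \<sigma>
    by (simp add: f_def sym_wave_permuted[OF that])
  moreover have "korobov_norm \<alpha> \<gamma> d I f < \<infinity>" using norm by (rule order_le_less_trans) simp
  ultimately have "f \<in> sym_korobov_space \<alpha> \<gamma> d I"
    unfolding sym_korobov_space_def korobov_space_def by blast
  with norm int zero show ?thesis by blast
qed

section \<open>Bounds for the minimal error\<close>

lemma min_error_le_1: "min_error N d (sym_korobov_space \<alpha> \<gamma> d I) (korobov_norm \<alpha> \<gamma> d I) \<le> 1"
  unfolding min_error_def
proof (rule INF_lower2)
  show "(\<lambda>_. 0, \<lambda>_. \<lambda>m\<in>{1..d}. 0) \<in> {(w, t). \<forall>n\<in>{1..N}. t n \<in> cube d}"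
    by (auto simp: cube_def)
  show "(case (\<lambda>_. 0, \<lambda>_. \<lambda>m\<in>{1..d}. 0) of (w, t) \<Rightarrow>
      SUP f\<in>{f \<in> sym_korobov_space \<alpha> \<gamma> d I. korobov_norm \<alpha> \<gamma> d I f \<le> 1}.
        ereal (cmod (integral_cube d f - cubature N w t f))) \<le> 1"
    by (auto intro!: SUP_least simp: cubature_def integral_le_korobov_norm)
qed

text \<open>
  A rule sees only function values at its nodes, so it assigns \<open>0\<close> to a function that vanishes there.
  Nodes of a rule may coincide; hence sets of at most \<open>N\<close> nodes.
\<close>

lemma min_error_lower_bound:
  assumes "\<And>T :: (nat \<Rightarrow> real) set. finite T \<Longrightarrow> card T \<le> N \<Longrightarrow>
    \<exists>f\<in>F. nrm f \<le> 1 \<and> integral_cube d f = complex_of_real \<nu> \<and> (\<forall>x\<in>T. f x = 0)"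
  shows "ereal \<nu> \<le> min_error N d F nrm"
  unfolding min_error_def
proof (rule INF_greatest, clarify)
  fix w and t :: "nat \<Rightarrow> nat \<Rightarrow> real"
  have "card (t ` {1..N}) \<le> N" using card_image_le[of "{1..N}" t] by simp
  then obtain f where f: "f \<in> F" "nrm f \<le> 1" "integral_cube d f = complex_of_real \<nu>"
    "\<forall>n\<in>{1..N}. f (t n) = 0"
    using assms[of "t ` {1..N}"] by auto
  have "ereal \<nu> \<le> ereal (cmod (integral_cube d f - cubature N w t f))"
    using f(3,4) by (simp add: cubature_def)
  also have "\<dots> \<le> (SUP f\<in>{f \<in> F. nrm f \<le> 1}. ereal (cmod (integral_cube d f - cubature N w t f)))"
    using f(1,2) by (intro SUP_upper) auto
  finally show "ereal \<nu> \<le> (SUP f\<in>{f \<in> F. nrm f \<le> 1}. ereal (cmod (integral_cube d f - cubature N w t f)))" .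
qed

theorem theorem2:
  fixes \<alpha> :: real
    and \<gamma> :: "nat \<Rightarrow> nat \<Rightarrow> real"
    and I :: "nat \<Rightarrow> nat set"
    and \<psi> :: "nat \<Rightarrow> nat \<Rightarrow> (nat \<Rightarrow> int)"
    and \<nu> :: "nat \<Rightarrow> nat \<Rightarrow> real"
  assumes "\<alpha> > 1"
    and "product_weights \<gamma>"
    and "\<And>d. d \<ge> 1 \<Longrightarrow> I d \<subseteq> {1..d} \<and> I d = {1..card (I d)}"
    and "\<And>d. d \<ge> 1 \<Longrightarrow> bij_betw (\<psi> d) {0..<card (nabla d (I d))} (nabla d (I d))"
    and "\<And>d n. d \<ge> 1 \<Longrightarrow> n < card (nabla d (I d)) \<Longrightarrow> \<nu> d n = mu_weight \<gamma> d (I d) (\<psi> d n)"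
    and "\<And>d n. d \<ge> 1 \<Longrightarrow> n + 1 < card (nabla d (I d)) \<Longrightarrow> \<nu> d (n + 1) \<le> \<nu> d n"
  shows "\<forall>d\<ge>1. \<forall>N<Nstar d (I d).
           ereal (\<nu> d N)
             \<le> min_error N d (sym_korobov_space \<alpha> \<gamma> d (I d)) (korobov_norm \<alpha> \<gamma> d (I d)) \<and>
           min_error N d (sym_korobov_space \<alpha> \<gamma> d (I d)) (korobov_norm \<alpha> \<gamma> d (I d)) \<le> 1"
proof (intro allI impI conjI)
  fix d N assume d: "d \<ge> (1::nat)" and N: "N < Nstar d (I d)"
  show "min_error N d (sym_korobov_space \<alpha> \<gamma> d (I d)) (korobov_norm \<alpha> \<gamma> d (I d)) \<le> 1"
    by (rule min_error_le_1)
  have I: "I d \<subseteq> {1..d}" "I d = {1..card (I d)}" using assms(3)[OF d] by auto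
  have Nn: "N < card (nabla d (I d))" using N Nstar_le_card_nabla[OF I] by simp
  have dec: "\<nu> d N \<le> \<nu> d j" if "j \<le> N" for j
    using that Nn
  proof (induction N rule: dec_induct)
    case (step n)
    then show ?case using assms(6)[OF d, of n] by auto
  qed simp
  have inj: "inj_on (\<psi> d) {..N}" and im: "\<psi> d ` {..N} \<subseteq> nabla d (I d)"
    using assms(4)[OF d] Nn by (auto simp: bij_betw_def inj_on_def)
  show "ereal (\<nu> d N) \<le> min_error N d (sym_korobov_space \<alpha> \<gamma> d (I d)) (korobov_norm \<alpha> \<gamma> d (I d))"
  proof (rule min_error_lower_bound, rule fooling_function[OF assms(2) I(1) im])
    show "0 \<le> \<nu> d N" using assms(5)[OF d Nn] mu_weight_unit(1)[OF assms(2)] by simp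
    show "\<nu> d N \<le> mu_weight \<gamma> d (I d) k" if "k \<in> \<psi> d ` {..N}" for k
      using that dec assms(5)[OF d] Nn by fastforce
    show "card T < card (\<psi> d ` {..N})" if "card T \<le> N" for T :: "(nat \<Rightarrow> real) set"
      using that by (simp add: card_image[OF inj])
  qed
qed

end
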